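(* Let $l\ge0$ be an integer, $n=[l/2]$ and $d=[(l+1)/2]$ (integer parts). Let $C$ be the vector space with basis $c_1,\dots,c_d$, and for $i=1,\dots,n$ put $W_i=\langle c_1,\dots,c_i\rangle\subseteq C$ and $V_i=\langle c_{i+1},\dots,c_d\rangle\subseteq C$. Then the Green algebra $G_l$ is an algebra of type $R_{\mathfrak F}$ for the family $\mathfrak F=\{V_1,W_1;\ldots;V_n,W_n\}$; that is, $\mathfrak F$ satisfies Property (G) and $G_l\cong R_{\mathfrak F}$.
   Context: $\Bbbk$ is an infinite field. $Q_{p,q}$ is the quiver with vertices $1,2$, with $p$ arrows $c_1,\dots,c_p$ from $1$ to $2$ and $q$ arrows $b_1,\dots,b_q$ from $2$ to $1$; paths are composed right to left. **Green algebras.** For $n\ge0$, $G_{2n+1}=\Bbbk Q_{n+1,n}/I_{2n+1}$ and $G_{2n}=\Bbbk Q_{n,n}/I_{2n}$, where each ideal is generated by: i) $b_ic_j$ for $i<j$; ii) $c_jb_i$ for $j\le i$. (So $G_0=\Bbbk\times\Bbbk$ and $G_1=\Bbbk Q_{1,0}$.) **Algebras of type $R_{\mathfrak F}$.** Let $C$ be a $\Bbbk$-vector space of dimension $p$ with basis $c_1,\dots,c_p$, and let $\mathfrak F=\{V_1,W_1;\ldots;V_q,W_q\}$ be a family of subspaces of $C$ with $\dim V_i=\operatorname{codim}W_i=k_i$, $0\le k_q\le\cdots\le k_1\le p$. Property (G): $V_i\cap W_j=0$ for all $i\ge j$. For such a family, $R_{\mathfrak F}=\Bbbk Q_{p,q}/I_{\mathfrak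 F}$, where $I_{\mathfrak F}$ is generated by: 1) $b_icb_j$ for all $c\in C$ and $i\le j$; 2) $b_iv$ for all $v\in V_i$; 3) $wb_i$ for all $w\in W_i$. *)

theory Defs
  imports
    "HOL-Algebra.QuotRing"
    "HOL-Algebra.Module"
    "HOL-Library.Poly_Mapping"
    "Graph_Theory.Arc_Walk"
begin

section \<open>Finitely supported functions as a vector space\<close>

definition pm_scale :: "'k::field \<Rightarrow> ('a \<Rightarrow>\<^sub>0 'k) \<Rightarrow> ('a \<Rightarrow>\<^sub>0 'k)" where
  "pm_scale a f = Poly_Mapping.map ((*) a) f"

lemma lookup_pm_scale [simp]:
  "Poly_Mapping.lookup (pm_scale a f) x = a * Poly_Mapping.lookup f x"
  by (simp add: pm_scale_def Poly_Mapping.map.rep_eq when_def)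

interpretation pm: vector_space "pm_scale :: 'k::field \<Rightarrow> ('a \<Rightarrow>\<^sub>0 'k) \<Rightarrow> ('a \<Rightarrow>\<^sub>0 'k)"
  by unfold_locales (auto intro!: poly_mapping_eqI simp: lookup_add algebra_simps)

section \<open>Path algebras\<close>

text \<open>
  A quiver is a \<open>pre_digraph\<close>; parallel arrows and loops are allowed.
  The triple \<open>(u, p, v)\<close> stands for the path from \<open>u\<close> to \<open>v\<close> traversing the arrows in
  the list \<open>p\<close> from left to right; \<open>(u, [], u)\<close> is the trivial path at \<open>u\<close>.
\<close>

type_synonym ('v, 'e) qpath = "'v \<times> 'e list \<times> 'v"

definition qpaths :: "('v, 'e) pre_digraph \<Rightarrow> ('v, 'e) qpath set" where
  "qpaths Q = {(u, p, v). pre_digraph.awalk Q u p v}"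

text \<open>
  Paths compose from right to left: in the product of \<open>x\<close> and \<open>y\<close>, the path \<open>y\<close> is traversed
  first, so the product is nonzero only if \<open>y\<close> ends where \<open>x\<close> starts.
\<close>

fun path_mult :: "('v, 'e) qpath \<Rightarrow> ('v, 'e) qpath \<Rightarrow> ('v, 'e) qpath \<Rightarrow>\<^sub>0 'k::field" where
  "path_mult (u, p, v) (u', p', v') =
     (if v' = u then Poly_Mapping.single (u', p' @ p, v) 1 else 0)"

definition pa_mult ::
  "(('v, 'e) qpath \<Rightarrow>\<^sub>0 'k::field) \<Rightarrow> (('v, 'e) qpath \<Rightarrow>\<^sub>0 'k) \<Rightarrow> (('v, 'e) qpath \<Rightarrow>\<^sub>0 'k)" where
  "pa_mult f g =
     (\<Sum>x\<in>Poly_Mapping.keys f. \<Sum>y\<in>Poly_Mapping.keys g.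
        pm_scale (Poly_Mapping.lookup f x * Poly_Mapping.lookup g y) (path_mult x y))"

definition path_algebra ::
  "('v, 'e) pre_digraph \<Rightarrow> ('k::field, ('v, 'e) qpath \<Rightarrow>\<^sub>0 'k) module" where
  "path_algebra Q =
     \<lparr>carrier = {f. Poly_Mapping.keys f \<subseteq> qpaths Q},
      monoid.mult = pa_mult,
      one = (\<Sum>v\<in>verts Q. Poly_Mapping.single (v, [], v) 1),
      zero = 0,
      add = (+),
      smult = pm_scale\<rparr>"

subsection \<open>The path algebra of a finite quiver is a ring\<close>

lemma pa_mult_superset:
  assumes "finite A" "finite B" "Poly_Mapping.keys f \<subseteq> A" "Poly_Mapping.keys g \<subseteq> B"
  shows "pa_mult f g = (\<Sum>x\<in>A. \<Sum>y\<in>B.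
     pm_scale (Poly_Mapping.lookup f x * Poly_Mapping.lookup g y) (path_mult x y))"
proof -
  have "(\<Sum>x\<in>A. \<Sum>y\<in>B.
      pm_scale (Poly_Mapping.lookup f x * Poly_Mapping.lookup g y) (path_mult x y))
    = (\<Sum>x\<in>Poly_Mapping.keys f. \<Sum>y\<in>B.
      pm_scale (Poly_Mapping.lookup f x * Poly_Mapping.lookup g y) (path_mult x y))"
    using assms by (intro sum.mono_neutral_right) (auto simp: in_keys_iff)
  also have "\<dots> = pa_mult f g"
    unfolding pa_mult_def
    using assms by (intro sum.cong sum.mono_neutral_right refl) (auto simp: in_keys_iff)
  finally show ?thesis ..
qed

lemma pa_mult_add_left: "pa_mult (f + f') g = pa_mult f g + pa_mult f' g"
proof -
  let ?A = "Poly_Mapping.keys f \<union> Poly_Mapping.keys f'"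
  let ?B = "Poly_Mapping.keys g"
  have *: "Poly_Mapping.keys (f + f') \<subseteq> ?A" by (rule keys_add)
  show ?thesis
    by (subst (1 2 3) pa_mult_superset[of ?A ?B])
       (use * in \<open>auto simp: lookup_add distrib_right pm.scale_left_distrib sum.distrib\<close>)
qed

lemma pa_mult_add_right: "pa_mult g (f + f') = pa_mult g f + pa_mult g f'"
proof -
  let ?A = "Poly_Mapping.keys f \<union> Poly_Mapping.keys f'"
  let ?B = "Poly_Mapping.keys g"
  have *: "Poly_Mapping.keys (f + f') \<subseteq> ?A" by (rule keys_add)
  show ?thesis
    by (subst (1 2 3) pa_mult_superset[of ?B ?A])
       (use * in \<open>auto simp: lookup_add distrib_left pm.scale_left_distrib sum.distrib\<close>)
qed

lemma pa_mult_zero [simp]: "pa_mult 0 f = 0" "pa_mult f 0 = 0"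
  by (simp_all add: pa_mult_def)

lemma pa_mult_single:
  "pa_mult (Poly_Mapping.single x a) (Poly_Mapping.single y b) = pm_scale (a * b) (path_mult x y)"
  by (subst pa_mult_superset[of "{x}" "{y}"]) auto

lemma pm_scale_single [simp]:
  "pm_scale a (Poly_Mapping.single x b) = Poly_Mapping.single x (a * b)"
  by (rule poly_mapping_eqI) (simp add: lookup_single when_def)

lemma pm_sum_single:
  "(\<Sum>x\<in>Poly_Mapping.keys f. Poly_Mapping.single x (Poly_Mapping.lookup f x)) = f"
  by (rule poly_mapping_eqI) (simp add: lookup_sum lookup_single when_def in_keys_iff)

lemma pm_induct [case_names zero single add]:
  fixes f :: "'a \<Rightarrow>\<^sub>0 'k::field"
  assumes "P 0" "\<And>x a. P (Poly_Mapping.single x a)" "\<And>f g. P f \<Longrightarrow> P g \<Longrightarrow> P (f + g)"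
  shows "P f"
proof -
  have "P (\<Sum>x\<in>A. Poly_Mapping.single x (Poly_Mapping.lookup f x))" if "finite A" for A
    using that by (induction A rule: finite_induct) (auto intro: assms)
  from this[of "Poly_Mapping.keys f"] show ?thesis
    by (simp add: pm_sum_single)
qed

lemma pa_mult_assoc: "pa_mult (pa_mult f g) h = pa_mult f (pa_mult g h)"
proof (induction f rule: pm_induct)
  case (single x a)
  show ?case
  proof (induction g rule: pm_induct)
    case (single y b)
    show ?case
    proof (induction h rule: pm_induct)
      case (single z c)
      show ?case
        by (cases x; cases y; cases z) (auto simp: pa_mult_single mult.assoc)
    qed (simp_all add: pa_mult_add_right)
  qed (simp_all add: pa_mult_add_right pa_mult_add_left)
qed (simp_all add: pa_mult_add_left)

lemma keys_sum_subset:
  "(\<And>x. x \<in> A \<Longrightarrow> Poly_Mapping.keys (F x) \<subseteq> S) \<Longrightarrow> Poly_Mapping.keys (sum F A) \<subseteq> S"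
  using keys_sum[of F A] by blast

lemma qpaths_iff:
  assumes "wf_digraph Q"
  shows "(u, p, v) \<in> qpaths Q \<longleftrightarrow>
    u \<in> verts Q \<and> v \<in> verts Q \<and> set p \<subseteq> arcs Q \<and> pre_digraph.cas Q u p v"
  unfolding qpaths_def
  using wf_digraph.awalk_hd_in_verts[OF assms] wf_digraph.awalk_last_in_verts[OF assms]
  by (auto simp: pre_digraph.awalk_def)

lemma pa_mult_closed:
  fixes f g :: "('v, 'e) qpath \<Rightarrow>\<^sub>0 'k::field"
  assumes "wf_digraph Q" "Poly_Mapping.keys f \<subseteq> qpaths Q" "Poly_Mapping.keys g \<subseteq> qpaths Q"
  shows "Poly_Mapping.keys (pa_mult f g) \<subseteq> qpaths Q"
proof -
  have "Poly_Mapping.keys (pm_scale c (path_mult x y)) \<subseteq> qpaths Q"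
    if "x \<in> qpaths Q" "y \<in> qpaths Q" for c :: 'k and x y
    using that
    by (cases x; cases y)
       (auto simp: qpaths_def intro: wf_digraph.awalk_appendI[OF assms(1)])
  then show ?thesis
    unfolding pa_mult_def by (intro keys_sum_subset) (use assms in blast)
qed

lemma pa_mult_sum_left: "pa_mult (sum F A) g = (\<Sum>x\<in>A. pa_mult (F x) g)"
  by (induction A rule: infinite_finite_induct) (auto simp: pa_mult_add_left)

lemma pa_mult_sum_right: "pa_mult g (sum F A) = (\<Sum>x\<in>A. pa_mult g (F x))"
  by (induction A rule: infinite_finite_induct) (auto simp: pa_mult_add_right)

lemma pa_one_mult:
  fixes f :: "('v, 'e) qpath \<Rightarrow>\<^sub>0 'k::field"
  assumes "wf_digraph Q" "finite (verts Q)" "Poly_Mapping.keys f \<subseteq> qpaths Q"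
  defines "e \<equiv> \<Sum>v\<in>verts Q. Poly_Mapping.single (v, [], v) (1 :: 'k)"
  shows "pa_mult e f = f" "pa_mult f e = f"
proof -
  have l: "pa_mult e (Poly_Mapping.single x a) = Poly_Mapping.single x a"
   and r: "pa_mult (Poly_Mapping.single x a) e = Poly_Mapping.single x a"
    if "x \<in> qpaths Q" for x and a :: 'k
  proof -
    obtain u p v where x: "x = (u, p, v)" by (cases x)
    have *: "u \<in> verts Q" "v \<in> verts Q" using that qpaths_iff[OF assms(1)] x by auto
    have "pa_mult e (Poly_Mapping.single x a)
        = (\<Sum>w\<in>verts Q. if w = v then Poly_Mapping.single x a else 0)"
      unfolding e_def pa_mult_sum_left x by (intro sum.cong) (auto simp: pa_mult_single)
    then show "pa_mult e (Poly_Mapping.single x a) = Poly_Mapping.single x a"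
      using * assms(2) by simp
    have "pa_mult (Poly_Mapping.single x a) e
        = (\<Sum>w\<in>verts Q. if w = u then Poly_Mapping.single x a else 0)"
      unfolding e_def pa_mult_sum_right x by (intro sum.cong) (auto simp: pa_mult_single)
    then show "pa_mult (Poly_Mapping.single x a) e = Poly_Mapping.single x a"
      using * assms(2) by simp
  qed
  have f: "f = (\<Sum>x\<in>Poly_Mapping.keys f. Poly_Mapping.single x (Poly_Mapping.lookup f x))"
    by (simp add: pm_sum_single)
  have "pa_mult e f = (\<Sum>x\<in>Poly_Mapping.keys f. Poly_Mapping.single x (Poly_Mapping.lookup f x))"
    by (rule trans[OF arg_cong[OF f, of "\<lambda>g. pa_mult e g"]],
        unfold pa_mult_sum_right, intro sum.cong refl l) (use assms in blast)
  then show "pa_mult e f = f" by (simp add: pm_sum_single)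
  have "pa_mult f e = (\<Sum>x\<in>Poly_Mapping.keys f. Poly_Mapping.single x (Poly_Mapping.lookup f x))"
    by (rule trans[OF arg_cong[OF f, of "\<lambda>g. pa_mult g e"]],
        unfold pa_mult_sum_left, intro sum.cong refl r) (use assms in blast)
  then show "pa_mult f e = f" by (simp add: pm_sum_single)
qed

lemma path_algebra_ring:
  assumes "wf_digraph Q" "finite (verts Q)"
  shows "ring (path_algebra Q :: ('k::field, ('v, 'e) qpath \<Rightarrow>\<^sub>0 'k) module)"
proof (rule ringI)
  show "abelian_group (path_algebra Q :: ('k, ('v, 'e) qpath \<Rightarrow>\<^sub>0 'k) module)"
  proof (rule abelian_groupI)
    fix x :: "('v, 'e) qpath \<Rightarrow>\<^sub>0 'k"
    assume "x \<in> carrier (path_algebra Q)"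
    then show "\<exists>y\<in>carrier (path_algebra Q). y \<oplus>\<^bsub>path_algebra Q\<^esub> x = \<zero>\<^bsub>path_algebra Q\<^esub>"
      by (intro bexI[of _ "- x"]) (auto simp: path_algebra_def)
  next
    fix x y :: "('v, 'e) qpath \<Rightarrow>\<^sub>0 'k"
    assume "x \<in> carrier (path_algebra Q)" "y \<in> carrier (path_algebra Q)"
    then show "x \<oplus>\<^bsub>path_algebra Q\<^esub> y \<in> carrier (path_algebra Q)"
      using keys_add[of x y] by (auto simp: path_algebra_def)
  qed (simp_all add: path_algebra_def add_ac)
  show "Group.monoid (path_algebra Q :: ('k, ('v, 'e) qpath \<Rightarrow>\<^sub>0 'k) module)"
  proof (rule monoidI)
    show "\<one>\<^bsub>path_algebra Q\<^esub> \<in> carrier (path_algebra Q :: ('k, ('v, 'e) qpath \<Rightarrow>\<^sub>0 'k) module)"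
      unfolding path_algebra_def
      by (simp, intro keys_sum_subset)
         (simp add: qpaths_def pre_digraph.awalk_def pre_digraph.cas.simps)
  next
    fix x y :: "('v, 'e) qpath \<Rightarrow>\<^sub>0 'k"
    assume "x \<in> carrier (path_algebra Q)" "y \<in> carrier (path_algebra Q)"
    then show "x \<otimes>\<^bsub>path_algebra Q\<^esub> y \<in> carrier (path_algebra Q)"
      using pa_mult_closed[OF assms(1)] by (simp add: path_algebra_def)
  qed (use assms in \<open>simp_all add: path_algebra_def pa_mult_assoc pa_one_mult\<close>)
qed (auto simp: path_algebra_def pa_mult_add_left pa_mult_add_right)

section \<open>Quotient algebras and isomorphisms\<close>

text \<open>
  The scalar action on cosets is \<open>a \<odot> (I + x) = I + a \<odot> x\<close>, written in the style of
  \<open>rcoset_mult\<close>. It is well defined for every two-sided ideal \<open>I\<close> of a unital algebra, as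
  such an ideal is a subspace.
\<close>

definition quot_algebra ::
  "('k, 'a) module \<Rightarrow> 'a set \<Rightarrow> ('k, 'a set) module" where
  "quot_algebra A I = ring.extend (A Quot I)
     (module.fields (\<lambda>a X. \<Union>x\<in>X. I +>\<^bsub>A\<^esub> (a \<odot>\<^bsub>A\<^esub> x)))"

definition alg_iso :: "('k, 'a) module \<Rightarrow> ('k, 'b) module \<Rightarrow> ('a \<Rightarrow> 'b) set" where
  "alg_iso A B = {h \<in> ring_iso A B.
     \<forall>a. \<forall>x\<in>carrier A. h (a \<odot>\<^bsub>A\<^esub> x) = a \<odot>\<^bsub>B\<^esub> h x}"

definition alg_isomorphic :: "('k, 'a) module \<Rightarrow> ('k, 'b) module \<Rightarrow> bool" where
  "alg_isomorphic A B \<longleftrightarrow> alg_iso A B \<noteq> {}"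

section \<open>The quivers \<open>Q\<^bsub>p,q\<^esub>\<close>\<close>

datatype arrow = C_arrow nat | B_arrow nat

fun arrow_tail :: "arrow \<Rightarrow> nat" where
  "arrow_tail (C_arrow j) = 1"
| "arrow_tail (B_arrow i) = 2"

fun arrow_head :: "arrow \<Rightarrow> nat" where
  "arrow_head (C_arrow j) = 2"
| "arrow_head (B_arrow i) = 1"

definition quiver :: "nat \<Rightarrow> nat \<Rightarrow> (nat, arrow) pre_digraph" where
  "quiver p q = \<lparr>verts = {1, 2}, arcs = C_arrow ` {1..p} \<union> B_arrow ` {1..q},
     tail = arrow_tail, head = arrow_head\<rparr>"

type_synonym 'k pathvec = "(nat, arrow) qpath \<Rightarrow>\<^sub>0 'k"

abbreviation kQ :: "nat \<Rightarrow> nat \<Rightarrow> ('k::field, 'k pathvec) module" where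
  "kQ p q \<equiv> path_algebra (quiver p q)"

definition arrow_vec :: "arrow \<Rightarrow> 'k::field pathvec" where
  "arrow_vec e = Poly_Mapping.single (arrow_tail e, [e], arrow_head e) 1"

abbreviation cvec :: "nat \<Rightarrow> 'k::field pathvec" where "cvec j \<equiv> arrow_vec (C_arrow j)"
abbreviation bvec :: "nat \<Rightarrow> 'k::field pathvec" where "bvec i \<equiv> arrow_vec (B_arrow i)"

lemma kQ_ring: "ring (kQ p q :: ('k::field, 'k pathvec) module)"
  by (rule path_algebra_ring) (auto simp: quiver_def wf_digraph_def)

section \<open>Green algebras\<close>

definition green_relations :: "nat \<Rightarrow> nat \<Rightarrow> 'k::field pathvec set" where
  "green_relations p q =
     {bvec i \<otimes>\<^bsub>kQ p q\<^esub> cvec j | i j. i \<in> {1..q} \<and> j \<in> {1..p} \<and> i < j} \<union>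
     {cvec j \<otimes>\<^bsub>kQ p q\<^esub> bvec i | i j. i \<in> {1..q} \<and> j \<in> {1..p} \<and> j \<le> i}"

definition green_algebra :: "nat \<Rightarrow> ('k::field, 'k pathvec set) module" where
  "green_algebra l =
     (let n = l div 2; p = (if even l then n else n + 1)
      in quot_algebra (kQ p n) (Idl\<^bsub>kQ p n\<^esub> (green_relations p n)))"

section \<open>Algebras of type \<open>R\<^sub>F\<close>\<close>

text \<open>
  The space \<open>C\<close> is realised inside the path algebra, its basis being the arrows from 1 to 2
  themselves, so that a product of an element of \<open>C\<close> with \<open>bvec i\<close> is just the product there.
\<close>

definition C_space :: "nat \<Rightarrow> 'k::field pathvec set" where
  "C_space p = pm.span (cvec ` {1..p})"

definition codim :: "nat \<Rightarrow> 'k::field pathvec set \<Rightarrow> nat" where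
  "codim p W = pm.dim (C_space p :: 'k pathvec set) - pm.dim W"

definition subspace_family ::
  "nat \<Rightarrow> nat \<Rightarrow> (nat \<Rightarrow> 'k::field pathvec set) \<Rightarrow> (nat \<Rightarrow> 'k pathvec set) \<Rightarrow> bool" where
  "subspace_family p q V W \<longleftrightarrow>
     (\<forall>i\<in>{1..q}. pm.subspace (V i) \<and> V i \<subseteq> C_space p \<and> pm.subspace (W i) \<and> W i \<subseteq> C_space p) \<and>
     (\<exists>k :: nat \<Rightarrow> nat.
        (\<forall>i\<in>{1..q}. pm.dim (V i) = k i \<and> codim p (W i) = k i \<and> k i \<le> p) \<and>
        (\<forall>i\<in>{1..q}. \<forall>j\<in>{1..q}. i \<le> j \<longrightarrow> k j \<le> k i))"

definition property_G ::
  "nat \<Rightarrow> (nat \<Rightarrow> 'k::field pathvec set) \<Rightarrow> (nat \<Rightarrow> 'k pathvec set) \<Rightarrow> bool" where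
  "property_G q V W \<longleftrightarrow> (\<forall>i\<in>{1..q}. \<forall>j\<in>{1..q}. j \<le> i \<longrightarrow> V i \<inter> W j = {0})"

definition R_relations ::
  "nat \<Rightarrow> nat \<Rightarrow> (nat \<Rightarrow> 'k::field pathvec set) \<Rightarrow> (nat \<Rightarrow> 'k pathvec set) \<Rightarrow> 'k pathvec set" where
  "R_relations p q V W =
     {bvec i \<otimes>\<^bsub>kQ p q\<^esub> x \<otimes>\<^bsub>kQ p q\<^esub> bvec j | i x j.
        i \<in> {1..q} \<and> j \<in> {1..q} \<and> i \<le> j \<and> x \<in> C_space p} \<union>
     {bvec i \<otimes>\<^bsub>kQ p q\<^esub> v | i v. i \<in> {1..q} \<and> v \<in> V i} \<union>
     {w \<otimes>\<^bsub>kQ p q\<^esub> bvec i | i w. i \<in> {1..q} \<and> w \<in> W i}"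

definition R_algebra ::
  "nat \<Rightarrow> nat \<Rightarrow> (nat \<Rightarrow> 'k::field pathvec set) \<Rightarrow> (nat \<Rightarrow> 'k pathvec set)
     \<Rightarrow> ('k, 'k pathvec set) module" where
  "R_algebra p q V W = quot_algebra (kQ p q) (Idl\<^bsub>kQ p q\<^esub> (R_relations p q V W))"

end

theory Submission
  imports Defs
begin

text \<open>
  Both algebras are quotients of the same path algebra, and the two ideals coincide: the
  relations 2) and 3) are the linear span of the Green relations, while every \<open>b\<^sub>i c\<^sub>k b\<^sub>j\<close> with
  \<open>i \<le> j\<close> lies in the Green ideal because either \<open>i < k\<close>, so that \<open>b\<^sub>i c\<^sub>k\<close> is a Green relation,
  or \<open>k \<le> i \<le> j\<close>, so that \<open>c\<^sub>k b\<^sub>j\<close> is one.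
\<close>

text \<open>The functions supported in \<open>S\<close> form a subspace containing the generators.
  Independence and trivial intersections below thus reduce to comparing supports.\<close>

lemma keys_pm_span:
  assumes "f \<in> pm.span ((\<lambda>x. Poly_Mapping.single x (1 :: 'k::field)) ` S)"
  shows "Poly_Mapping.keys f \<subseteq> S"
proof -
  have "pm.subspace {f :: 'a \<Rightarrow>\<^sub>0 'k. Poly_Mapping.keys f \<subseteq> S}"
    unfolding pm.subspace_def
    by (auto dest: subsetD[OF keys_add]) (auto simp: in_keys_iff)
  then have "pm.span ((\<lambda>x. Poly_Mapping.single x 1) ` S) \<subseteq> {f :: 'a \<Rightarrow>\<^sub>0 'k. Poly_Mapping.keys f \<subseteq> S}"
    by (rule pm.span_minimal[rotated]) auto
  then show ?thesis using assms by blast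
qed

lemma pa_mult_scale_left: "pa_mult (pm_scale a f) g = pm_scale a (pa_mult f g)"
proof (induction f rule: pm_induct)
  case (single x b)
  show ?case
    by (induction g rule: pm_induct)
       (simp_all add: pa_mult_single pa_mult_add_right pm.scale_right_distrib mult.assoc)
qed (simp_all add: pa_mult_add_left pm.scale_right_distrib)

lemma pa_mult_scale_right: "pa_mult f (pm_scale a g) = pm_scale a (pa_mult f g)"
proof (induction f rule: pm_induct)
  case (single x b)
  show ?case
    by (induction g rule: pm_induct)
       (simp_all add: pa_mult_single pa_mult_add_right pm.scale_right_distrib mult_ac)
qed (simp_all add: pa_mult_add_left pm.scale_right_distrib)

text \<open>An \<open>ideal\<close> is closed only under sums and ring multiplication, but the
  scalar \<open>a\<close> acts as multiplication by the ring element \<open>a\<close> times the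
  unit.\<close>

lemma path_algebra_ideal_subspace:
  fixes I :: "(('v, 'e) qpath \<Rightarrow>\<^sub>0 'k::field) set"
  assumes "wf_digraph Q" "finite (verts Q)" "ideal I (path_algebra Q)"
  shows "pm.subspace I"
proof -
  let ?R = "path_algebra Q :: ('k, ('v, 'e) qpath \<Rightarrow>\<^sub>0 'k) module"
  interpret ideal I ?R by fact
  have "pm_scale a x \<in> I" if x: "x \<in> I" for a x
  proof -
    have xR: "x \<in> carrier ?R" using x Icarr by blast
    have one: "pm_scale a \<one>\<^bsub>?R\<^esub> \<in> carrier ?R"
      using one_closed by (auto simp: path_algebra_def in_keys_iff subset_iff)
    have "pm_scale a x = pm_scale a \<one>\<^bsub>?R\<^esub> \<otimes>\<^bsub>?R\<^esub> x"
      using l_one[OF xR] by (simp add: path_algebra_def pa_mult_scale_left)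
    then show ?thesis using I_l_closed[OF x one] by simp
  qed
  moreover have "0 \<in> I"
    using additive_subgroup.zero_closed[OF is_additive_subgroup] by (simp add: path_algebra_def)
  moreover have "x + y \<in> I" if "x \<in> I" "y \<in> I" for x y
    using additive_subgroup.a_closed[OF is_additive_subgroup that] by (simp add: path_algebra_def)
  ultimately show ?thesis by (auto simp: pm.subspace_def)
qed

text \<open>The product is linear in \<open>x\<close>. With the right-hand version below, this lets
  membership of a product in an ideal be checked on basis arrows alone.\<close>

lemma pa_mult_span_left:
  assumes "pm.subspace I" "\<And>s. s \<in> S \<Longrightarrow> pa_mult s y \<in> I" "x \<in> pm.span S"
  shows "pa_mult x y \<in> I"
  using assms(3)
proof (induction rule: pm.span_induct)
  \<comment> \<open>In \<open>pm.span_induct\<close>, this case asks that the \<open>x\<close> with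
    \<open>pa_mult x y \<in> I\<close> form a subspace.\<close>
  case base
  show ?case
    using assms(1) by (auto simp: pm.subspace_def pa_mult_add_left pa_mult_scale_left)
qed (rule assms(2))

lemma pa_mult_span_right:
  assumes "pm.subspace I" "\<And>s. s \<in> S \<Longrightarrow> pa_mult y s \<in> I" "x \<in> pm.span S"
  shows "pa_mult y x \<in> I"
  using assms(3)
proof (induction rule: pm.span_induct)
  case base
  show ?case
    using assms(1) by (auto simp: pm.subspace_def pa_mult_add_right pa_mult_scale_right)
qed (rule assms(2))

lemma alg_isomorphic_refl: "alg_isomorphic A A"
proof -
  have "id \<in> alg_iso A A"
    by (auto simp: alg_iso_def ring_iso_def ring_hom_def)
  then show ?thesis by (auto simp: alg_isomorphic_def)
qed

lemma wf_quiver: "wf_digraph (quiver p q)" "finite (verts (quiver p q))"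
  by (auto simp: quiver_def wf_digraph_def)

lemma arrow_vec_in_carrier:
  assumes "e \<in> arcs (quiver p q)"
  shows "(arrow_vec e :: 'k::field pathvec) \<in> carrier (kQ p q)"
  using assms
  by (auto simp: path_algebra_def arrow_vec_def qpaths_iff wf_quiver)
     (auto simp: quiver_def pre_digraph.cas.simps)

lemma cvec_span_in_carrier:
  assumes "x \<in> pm.span (cvec ` {1..p})"
  shows "(x :: 'k::field pathvec) \<in> carrier (kQ p q)"
proof -
  \<comment> \<open>The carrier is the unit ideal, so the result on ideals applies to it.\<close>
  have "pm.subspace (carrier (kQ p q :: ('k, 'k pathvec) module))"
    by (intro path_algebra_ideal_subspace[of "quiver p q"] wf_quiver ring.oneideal kQ_ring)
  moreover have "cvec ` {1..p} \<subseteq> carrier (kQ p q :: ('k, 'k pathvec) module)"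
    by (intro image_subsetI arrow_vec_in_carrier) (simp add: quiver_def)
  ultimately show ?thesis using pm.span_minimal assms by blast
qed

lemma cvec_image: "cvec ` A = (\<lambda>x. Poly_Mapping.single x 1) ` (\<lambda>j. (1, [C_arrow j], 2)) ` A"
  by (auto simp: arrow_vec_def image_image)

lemma keys_cvec_span:
  "f \<in> pm.span (cvec ` A) \<Longrightarrow> Poly_Mapping.keys f \<subseteq> (\<lambda>j. (1, [C_arrow j], 2)) ` A"
  unfolding cvec_image by (rule keys_pm_span)

lemma inj_cvec: "inj (cvec :: nat \<Rightarrow> 'k::field pathvec)"
  by (auto intro!: injI simp: arrow_vec_def dest: arg_cong[of _ _ Poly_Mapping.keys])

text \<open>A dependence would place some \<open>cvec j\<close> in the span of the remaining arrows,
  whose elements do not have the path of \<open>cvec j\<close> in their support.\<close>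

lemma independent_cvec: "pm.independent (cvec ` A :: 'k::field pathvec set)"
proof
  assume "pm.dependent (cvec ` A :: 'k pathvec set)"
  then obtain j where "(cvec j :: 'k pathvec) \<in> pm.span (cvec ` A - {cvec j})"
    by (auto simp: pm.dependent_def)
  moreover have "cvec ` A - {cvec j :: 'k pathvec} = cvec ` (A - {j})"
    using inj_cvec by (auto dest: injD)
  ultimately show False using keys_cvec_span by (fastforce simp: arrow_vec_def)
qed

lemma dim_cvec_span: "pm.dim (pm.span (cvec ` A :: 'k::field pathvec set)) = card A"
  using independent_cvec[of A, where 'k = 'k]
  by (simp add: pm.dim_eq_card_independent card_image inj_on_subset[OF inj_cvec])

lemma cvec_span_disjoint:
  assumes "A \<inter> B = {}"
  shows "pm.span (cvec ` A) \<inter> pm.span (cvec ` B) = ({0} :: 'k::field pathvec set)"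
proof -
  have "f = 0" if "f \<in> pm.span (cvec ` A)" "f \<in> pm.span (cvec ` B)" for f :: "'k pathvec"
  proof -
    have "Poly_Mapping.keys f = {}"
      using keys_cvec_span[OF that(1)] keys_cvec_span[OF that(2)] assms by fast
    then show ?thesis by simp
  qed
  then show ?thesis by (auto simp: pm.span_zero)
qed

lemma Idl_R_relations_eq_green:
  fixes V W :: "nat \<Rightarrow> 'k::field pathvec set"
  assumes "n \<le> d"
    and W: "\<And>i. i \<in> {1..n} \<Longrightarrow> W i = pm.span (cvec ` {1..i})"
    and V: "\<And>i. i \<in> {1..n} \<Longrightarrow> V i = pm.span (cvec ` {i + 1..d})"
  shows "Idl\<^bsub>kQ d n\<^esub> (green_relations d n) = Idl\<^bsub>kQ d n\<^esub> (R_relations d n V W)"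
proof -
  let ?K = "kQ d n :: ('k, 'k pathvec) module"
  let ?G = "green_relations d n :: 'k pathvec set"
  let ?I = "Idl\<^bsub>?K\<^esub> ?G"
  interpret K: ring ?K by (rule kQ_ring)
  have mult: "x \<otimes>\<^bsub>?K\<^esub> y = pa_mult x y" for x y by (simp add: path_algebra_def)
  have b: "bvec i \<in> carrier ?K" if "i \<in> {1..n}" for i
    using that by (intro arrow_vec_in_carrier) (auto simp: quiver_def)
  have c: "cvec j \<in> carrier ?K" if "j \<in> {1..d}" for j
    using that by (intro arrow_vec_in_carrier) (auto simp: quiver_def)
  \<comment> \<open>The inclusion of \<open>W i\<close> rests on \<open>i \<le> n \<le> d\<close>:
    the indices \<open>1..i\<close> must be indices of basis arrows of C.\<close>
  have VC: "V i \<subseteq> C_space d" and WC: "W i \<subseteq> C_space d" if "i \<in> {1..n}" for i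
    using that assms(1) unfolding V[OF that] W[OF that] C_space_def
    by (auto intro!: pm.span_mono)
  have C: "x \<in> carrier ?K" if "x \<in> C_space d" for x
    using that cvec_span_in_carrier unfolding C_space_def by blast
  have Gcarr: "?G \<subseteq> carrier ?K"
    using b c by (auto simp: green_relations_def simp del: One_nat_def)
  have Rcarr: "R_relations d n V W \<subseteq> carrier ?K"
    using b C subsetD[OF VC, THEN C] subsetD[OF WC, THEN C]
    unfolding R_relations_def by (auto intro!: K.m_closed)
  have I: "ideal ?I ?K" by (rule K.genideal_ideal[OF Gcarr])
  then have sub: "pm.subspace ?I" using path_algebra_ideal_subspace wf_quiver by blast
  have gen: "?G \<subseteq> ?I" by (rule K.genideal_self[OF Gcarr])
  have bc: "pa_mult (bvec i) (cvec j) \<in> ?I" if "i \<in> {1..n}" "j \<in> {1..d}" "i < j" for i j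
    using gen that unfolding green_relations_def mult by blast
  have cb: "pa_mult (cvec j) (bvec i) \<in> ?I" if "i \<in> {1..n}" "j \<in> {1..d}" "j \<le> i" for i j
    using gen that unfolding green_relations_def mult by blast
  have bcb: "pa_mult (bvec i) (pa_mult (cvec k) (bvec j)) \<in> ?I"
    if "i \<in> {1..n}" "j \<in> {1..n}" "i \<le> j" "k \<in> {1..d}" for i j k
  proof (cases "i < k")
    case True
    then show ?thesis
      using ideal.I_r_closed[OF I bc b] that by (simp add: mult pa_mult_assoc)
  next
    case False
    then show ?thesis
      using ideal.I_l_closed[OF I cb b] that by (simp add: mult)
  qed
  have "pa_mult (bvec i) (pa_mult x (bvec j)) \<in> ?I"
    if "i \<in> {1..n}" "j \<in> {1..n}" "i \<le> j" "x \<in> C_space d" for i j x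
  proof -
    \<comment> \<open>The span lemmas treat one outer factor at a time, so linearity in the middle
      factor takes two stages: \<open>x\<close> times \<open>bvec j\<close> lies in the span of the
      products \<open>c\<^sub>k b\<^sub>j\<close>, and then \<open>bvec i\<close> is applied to that
      span.\<close>
    let ?S = "(\<lambda>c. pa_mult c (bvec j)) ` cvec ` {1..d}"
    have "pa_mult c (bvec j) \<in> pm.span ?S" if "c \<in> cvec ` {1..d}" for c
      by (rule pm.span_base, rule imageI, rule that)
    then have "pa_mult x (bvec j) \<in> pm.span ?S"
      using that(4) unfolding C_space_def by (rule pa_mult_span_left[OF pm.subspace_span])
    moreover have "pa_mult (bvec i) s \<in> ?I" if "s \<in> ?S" for s
      using \<open>s \<in> ?S\<close> bcb[OF \<open>i \<in> {1..n}\<close> \<open>j \<in> {1..n}\<close> \<open>i \<le> j\<close>] by blast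
    ultimately show ?thesis by (rule pa_mult_span_right[OF sub, rotated])
  qed
  moreover have "pa_mult (bvec i) v \<in> ?I" if "i \<in> {1..n}" "v \<in> V i" for i v
  proof (rule pa_mult_span_right[OF sub])
    show "v \<in> pm.span (cvec ` {i + 1..d})" using that(2) V[OF that(1)] by simp
    show "pa_mult (bvec i) s \<in> ?I" if "s \<in> cvec ` {i + 1..d}" for s
      using that bc \<open>i \<in> {1..n}\<close> by auto
  qed
  moreover have "pa_mult w (bvec i) \<in> ?I" if "i \<in> {1..n}" "w \<in> W i" for i w
  proof (rule pa_mult_span_left[OF sub])
    show "w \<in> pm.span (cvec ` {1..i})" using that(2) W[OF that(1)] by simp
    show "pa_mult s (bvec i) \<in> ?I" if "s \<in> cvec ` {1..i}" for s
      using that cb assms(1) \<open>i \<in> {1..n}\<close> by auto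
  qed
  \<comment> \<open>Relations 1) are bracketed to the left in the definition; associativity brings
    them to the form just proved.\<close>
  ultimately have "R_relations d n V W \<subseteq> ?I"
    unfolding R_relations_def mult pa_mult_assoc by blast
  \<comment> \<open>Each Green generator is itself a relation 2) or 3), because \<open>V i\<close>
    contains \<open>cvec j\<close> for \<open>i < j\<close> and \<open>W i\<close> contains it for
    \<open>j \<le> i\<close>.\<close>
  moreover have "?G \<subseteq> R_relations d n V W"
  proof -
    have "cvec j \<in> V i" if "i \<in> {1..n}" "j \<in> {1..d}" "i < j" for i j
      unfolding V[OF that(1)] using that by (intro pm.span_base) auto
    moreover have "cvec j \<in> W i" if "i \<in> {1..n}" "j \<in> {1..d}" "j \<le> i" for i j
      unfolding W[OF that(1)] using that by (intro pm.span_base) auto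
    ultimately show ?thesis unfolding green_relations_def R_relations_def by blast
  qed
  ultimately show ?thesis
    using K.genideal_minimal[OF I] K.genideal_minimal[OF K.genideal_ideal[OF Rcarr]]
      K.genideal_self[OF Rcarr] by blast
qed

theorem proposition3p1:
  fixes l n d :: nat and V W :: "nat \<Rightarrow> 'k::field pathvec set"
  assumes "infinite (UNIV :: 'k set)"
    and "n = l div 2" and "d = (l + 1) div 2"
    and "\<And>i. i \<in> {1..n} \<Longrightarrow> W i = pm.span (cvec ` {1..i})"
    and "\<And>i. i \<in> {1..n} \<Longrightarrow> V i = pm.span (cvec ` {i + 1..d})"
  shows "subspace_family d n V W \<and> property_G n V W \<and>
    alg_isomorphic (green_algebra l :: ('k, 'k pathvec set) module) (R_algebra d n V W)"
proof (intro conjI)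
  note W = assms(4) and V = assms(5)
  have nd: "n \<le> d" using assms(2,3) by simp
  have "pm.subspace (V i) \<and> V i \<subseteq> C_space d \<and> pm.subspace (W i) \<and> W i \<subseteq> C_space d"
    if "i \<in> {1..n}" for i
    using that nd unfolding V[OF that] W[OF that] C_space_def
    by (intro conjI pm.subspace_span pm.span_mono image_mono) auto
  \<comment> \<open>This supplies the witness \<open>k i = d - i\<close>: \<open>V i\<close> has
    \<open>d - i\<close> basis arrows, and \<open>W i\<close> omits exactly these. It decreases in
    \<open>i\<close>, as the ordering of the family demands.\<close>
  moreover have "pm.dim (V i) = d - i \<and> codim d (W i) = d - i \<and> d - i \<le> d"
    if "i \<in> {1..n}" for i
    unfolding V[OF that] W[OF that] codim_def C_space_def dim_cvec_span by simp
  ultimately show "subspace_family d n V W"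
    unfolding subspace_family_def by (intro conjI exI[of _ "\<lambda>i. d - i"]) auto
  \<comment> \<open>For \<open>j \<le> i\<close> the index sets \<open>{i + 1..d}\<close> and
    \<open>{1..j}\<close> are disjoint.\<close>
  have "V i \<inter> W j = {0}" if "i \<in> {1..n}" "j \<in> {1..n}" "j \<le> i" for i j
    unfolding V[OF that(1)] W[OF that(2)] using that by (intro cvec_span_disjoint) auto
  then show "property_G n V W" by (auto simp: property_G_def)
  \<comment> \<open>Both quotients are therefore taken over the same quiver, and equality of the
    ideals makes the algebras equal, so the identity is the isomorphism.\<close>
  have "(if even l then n else n + 1) = d" using assms(2,3) by auto
  then have "(green_algebra l :: ('k, 'k pathvec set) module) = R_algebra d n V W"
    using Idl_R_relations_eq_green[OF nd W V]
    by (simp only: green_algebra_def R_algebra_def Let_def assms(2)[symmetric])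
  then show "alg_isomorphic (green_algebra l :: ('k, 'k pathvec set) module) (R_algebra d n V W)"
    by (simp add: alg_isomorphic_refl)
qed

end
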